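(* Let $\bar\gamma>0$ and $0<\alpha\le 1$. Let $\gamma$ be the instantaneous SNR of the Rayleigh and double-Rayleigh (RDR) fading channel, i.e. the normalized SOSF fading channel with parameters $(\alpha,\beta)=(\alpha,0)$, with average SNR $\bar\gamma$. Then the CDF of $\gamma$ is, for $\gamma>0$, $$F_\gamma(\gamma)=1-e^{\frac{1-\alpha}{\alpha}}\, \Gamma\!\left(1,\frac{1-\alpha}{\alpha},\frac{\gamma}{\alpha \bar \gamma} \right).$$
   Context: SOSF (second order scattering fading) channel: $S=\omega_0e^{j\phi}+\omega_1G_1+\omega_2G_2G_3$, where $j$ is the imaginary unit, $\omega_0,\omega_1,\omega_2\ge 0$ are real constants with $\omega_0^2+\omega_1^2+\omega_2^2=1$, $\phi$ is uniform on $[0,2\pi)$, and $G_1,G_2,G_3$ are circularly-symmetric complex Gaussian random variables with mean $0$ and variance $\mathbb{E}|G_i|^2=1$; $\phi,G_1,G_2,G_3$ are mutually independent. The parameters are $\alpha=\omega_2^2$ and $\beta=\omega_0^2$ (so $\omega_1^2=1-\alpha-\beta$). The instantaneous SNR is $\gamma=\bar\gamma|S|^2$, so that $\mathbb{E}(\gamma)=\bar\gamma$. The generalized incomplete gamma function is $\Gamma(a,x,b)=\int_{x}^{\infty}t^{a-1} e^{-t}e^{-b/t}\,dt$. *)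

theory Defs
  imports "HOL-Probability.Probability"
begin

text \<open>A circularly-symmetric complex Gaussian of mean 0 and variance \<open>v\<close>, i.e.
  \<open>CN(0, v)\<close>: real and imaginary parts are independent, each normal with mean 0 and
  variance \<open>v / 2\<close>, so that the second absolute moment of \<open>Z\<close> is \<open>v\<close>.
  The second argument of \<^const>\<open>normal_density\<close> is the standard deviation.\<close>

definition circular_complex_gaussian :: "'a measure \<Rightarrow> real \<Rightarrow> ('a \<Rightarrow> complex) \<Rightarrow> bool" where
  "circular_complex_gaussian M v Z \<longleftrightarrow>
     prob_space.indep_var M borel (\<lambda>x. Re (Z x)) borel (\<lambda>x. Im (Z x)) \<and>
     distributed M lborel (\<lambda>x. Re (Z x)) (normal_density 0 (sqrt (v / 2))) \<and>
     distributed M lborel (\<lambda>x. Im (Z x)) (normal_density 0 (sqrt (v / 2)))"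

definition sosf :: "real \<Rightarrow> real \<Rightarrow> real \<Rightarrow> ('a \<Rightarrow> real) \<Rightarrow> ('a \<Rightarrow> complex) \<Rightarrow> ('a \<Rightarrow> complex) \<Rightarrow>
    ('a \<Rightarrow> complex) \<Rightarrow> 'a \<Rightarrow> complex" where
  "sosf \<omega>\<^sub>0 \<omega>\<^sub>1 \<omega>\<^sub>2 \<phi> G\<^sub>1 G\<^sub>2 G\<^sub>3 x =
     of_real \<omega>\<^sub>0 * exp (\<i> * of_real (\<phi> x)) + of_real \<omega>\<^sub>1 * G\<^sub>1 x + of_real \<omega>\<^sub>2 * G\<^sub>2 x * G\<^sub>3 x"

text \<open>\<^const>\<open>prob_space.indep_vars\<close> needs a common value type, so the real phase is embedded into
  the complex numbers; it generates the same sigma-algebra as the phase itself.\<close>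

locale sosf_channel = prob_space M
  for M :: "'a measure" +
  fixes \<omega>\<^sub>0 \<omega>\<^sub>1 \<omega>\<^sub>2 :: real
    and \<phi> :: "'a \<Rightarrow> real"
    and G\<^sub>1 G\<^sub>2 G\<^sub>3 :: "'a \<Rightarrow> complex"
  assumes weights_nonneg: "0 \<le> \<omega>\<^sub>0" "0 \<le> \<omega>\<^sub>1" "0 \<le> \<omega>\<^sub>2"
    and normalized: "\<omega>\<^sub>0\<^sup>2 + \<omega>\<^sub>1\<^sup>2 + \<omega>\<^sub>2\<^sup>2 = 1"
    and phase_uniform:
      "distributed M lborel \<phi> (\<lambda>t. indicator {0..<2 * pi} t / measure lborel {0..<2 * pi})"
    and gaussian: "circular_complex_gaussian M 1 G\<^sub>1" "circular_complex_gaussian M 1 G\<^sub>2"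
      "circular_complex_gaussian M 1 G\<^sub>3"
    and independent:
      "indep_vars (\<lambda>_. borel) (\<lambda>i. [\<lambda>x. complex_of_real (\<phi> x), G\<^sub>1, G\<^sub>2, G\<^sub>3] ! i) {..<4}"

definition snr :: "real \<Rightarrow> ('a \<Rightarrow> complex) \<Rightarrow> 'a \<Rightarrow> real" where
  "snr \<gamma>bar S x = \<gamma>bar * (cmod (S x))\<^sup>2"

definition gen_incomplete_Gamma :: "real \<Rightarrow> real \<Rightarrow> real \<Rightarrow> real" where
  "gen_incomplete_Gamma a x b = (LBINT t:{x<..}. t powr (a - 1) * exp (- t) * exp (- b / t))"

end

theory Submission
  imports Defs "HOL-Real_Asymp.Real_Asymp"
begin

text \<open>Condition on \<open>G\<^sub>3 = z\<close>. By rotation invariance and additivity of circular Gaussians,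
  \<open>S = \<omega>\<^sub>1 G\<^sub>1 + \<omega>\<^sub>2 G\<^sub>2 z\<close> is then \<open>CN(0, \<omega>\<^sub>1\<^sup>2 + \<omega>\<^sub>2\<^sup>2 \<bar>z\<bar>\<^sup>2)\<close>, so \<open>\<bar>S\<bar>\<^sup>2\<close> is conditionally exponential with
  that mean. Since \<open>u = \<bar>G\<^sub>3\<bar>\<^sup>2\<close> is itself exponential with mean 1,
  \<open>P(\<bar>S\<bar>\<^sup>2 > c) = \<integral>\<^sub>0\<^sup>\<infinity> e\<^sup>-\<^sup>u exp (- c / (1 - \<alpha> + \<alpha> u)) du\<close>, and the shift
  \<open>t = u + (1 - \<alpha>) / \<alpha>\<close> turns this into the generalized incomplete gamma function.\<close>

section \<open>Centred Gaussian laws on the line and in the complex plane\<close>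

definition component_normal :: "real \<Rightarrow> real measure" where
  "component_normal v = density lborel (normal_density 0 (sqrt (v / 2)))"

text \<open>The law CN(0, v) as a measure in its own right: conditioning on one of the independent
  factors then becomes iterated integration, with no random variables involved. The parameter is the
  second moment of the complex variable, so each component carries half of it.\<close>

definition complex_normal :: "real \<Rightarrow> complex measure" where
  "complex_normal v = distr (component_normal v \<Otimes>\<^sub>M component_normal v) borel (\<lambda>(x, y). Complex x y)"

lemma borel_measurable_Complex [measurable (raw)]:
  assumes [measurable]: "f \<in> borel_measurable M" "g \<in> borel_measurable M"
  shows "(\<lambda>x. Complex (f x) (g x)) \<in> borel_measurable M"
  by (simp add: borel_measurable_complex_iff)

lemma component_normal_density:
  assumes "0 < v"
  shows "normal_density 0 (sqrt (v / 2)) x = exp (- x\<^sup>2 / v) / sqrt (pi * v)"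
  using assms by (simp add: normal_density_def field_simps)

lemma sets_component_normal [simp, measurable_cong]: "sets (component_normal v) = sets borel"
  by (simp add: component_normal_def)

lemma space_component_normal [simp]: "space (component_normal v) = UNIV"
  by (simp add: component_normal_def)

lemma sets_complex_normal [simp, measurable_cong]: "sets (complex_normal v) = sets borel"
  by (simp add: complex_normal_def)

lemma space_complex_normal [simp]: "space (complex_normal v) = UNIV"
  by (simp add: complex_normal_def)

lemma prob_space_component_normal: "0 < v \<Longrightarrow> prob_space (component_normal v)"
  unfolding component_normal_def by (rule prob_space_normal_density) simp

lemma prob_space_complex_normal:
  assumes "0 < v"
  shows "prob_space (complex_normal v)"
proof -
  interpret N: prob_space "component_normal v"
    using assms by (rule prob_space_component_normal)
  interpret pair_prob_space "component_normal v" "component_normal v" ..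
  show ?thesis
    unfolding complex_normal_def by (rule prob_space_distr) measurable
qed

lemma nn_integral_component_normal:
  fixes f :: "real \<Rightarrow> ennreal"
  assumes [measurable]: "f \<in> borel_measurable borel"
  shows "(\<integral>\<^sup>+x. f x \<partial>component_normal v) = (\<integral>\<^sup>+x. normal_density 0 (sqrt (v / 2)) x * f x \<partial>lborel)"
  unfolding component_normal_def by (subst nn_integral_density) auto

text \<open>Laws are compared below mostly through integrals of nonnegative Borel functions, so that
  Tonelli applies without integrability conditions.\<close>

lemma nn_integral_complex_normal:
  fixes f :: "complex \<Rightarrow> ennreal"
  assumes "0 < v" and [measurable]: "f \<in> borel_measurable borel"
  shows "(\<integral>\<^sup>+z. f z \<partial>complex_normal v) =
    (\<integral>\<^sup>+x. \<integral>\<^sup>+y. f (Complex x y) \<partial>component_normal v \<partial>component_normal v)"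
proof -
  interpret N: prob_space "component_normal v"
    using assms(1) by (rule prob_space_component_normal)
  show ?thesis
    unfolding complex_normal_def
    by (simp add: nn_integral_distr N.nn_integral_fst[symmetric] case_prod_beta)
qed

section \<open>The radial density and rotation invariance\<close>

text \<open>The product of the two component densities depends on the point only through its
  modulus. Rotation invariance and the tail formula both rest on this form.\<close>

lemma nn_integral_complex_normal_density:
  fixes f :: "complex \<Rightarrow> ennreal"
  assumes "0 < v" and [measurable]: "f \<in> borel_measurable borel"
  shows "(\<integral>\<^sup>+z. f z \<partial>complex_normal v) =
    (\<integral>\<^sup>+x. \<integral>\<^sup>+y. exp (- (cmod (Complex x y))\<^sup>2 / v) / (pi * v) * f (Complex x y) \<partial>lborel \<partial>lborel)"
  using assms(1)
  by (simp add: nn_integral_complex_normal nn_integral_component_normal component_normal_density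
      nn_integral_cmult[symmetric] mult.assoc[symmetric] ennreal_mult'[symmetric] exp_add[symmetric]
      cmod_def diff_divide_distrib add_divide_distrib)

text \<open>When \<open>a = Re c \<noteq> 0\<close>, the rotation factors into two shears with a scaling of ratio \<open>a\<close> and
  \<open>1 / a\<close> respectively, each a one-dimensional substitution.\<close>

lemma nn_integral_lborel_rotation:
  fixes f :: "complex \<Rightarrow> ennreal"
  assumes c: "cmod c = 1" and [measurable]: "f \<in> borel_measurable borel"
  shows "(\<integral>\<^sup>+x. \<integral>\<^sup>+y. f (c * Complex x y) \<partial>lborel \<partial>lborel) =
    (\<integral>\<^sup>+x. \<integral>\<^sup>+y. f (Complex x y) \<partial>lborel \<partial>lborel)"
proof -
  obtain a b where c_eq: "c = Complex a b"
    by (cases c)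
  have ab: "a * a + b * b = 1"
    using c by (simp add: c_eq cmod_def power2_eq_square)
  have mult: "c * Complex x y = Complex (a * x - b * y) (b * x + a * y)" for x y
    by (simp add: c_eq complex_eq_iff)
  show ?thesis
  proof (cases "a = 0")
    \<comment> \<open>Multiplication by \<open>c\<close> is now a quarter turn: it exchanges the
      coordinates up to sign, so two reflections and Tonelli suffice.\<close>
    case True
    then have "\<bar>b\<bar> = 1"
      using ab by (metis abs_mult_self_eq abs_1 abs_ge_zero add_0 mult_zero_left real_sqrt_abs2 real_sqrt_one)
    then have b: "b \<noteq> 0" "ennreal \<bar>b\<bar> = 1" "ennreal \<bar>-b\<bar> = 1"
      by auto
    have "(\<integral>\<^sup>+x. \<integral>\<^sup>+y. f (Complex x y) \<partial>lborel \<partial>lborel) =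
        (\<integral>\<^sup>+u. \<integral>\<^sup>+x. f (Complex u (0 + b * x)) \<partial>lborel \<partial>lborel)"
      using b by (subst (2) nn_integral_real_affine[where c = b and t = 0]) auto
    also have "\<dots> = (\<integral>\<^sup>+y. \<integral>\<^sup>+x. f (Complex (0 + (- b) * y) (0 + b * x)) \<partial>lborel \<partial>lborel)"
      using b by (subst nn_integral_real_affine[where c = "- b" and t = 0]) auto
    also have "\<dots> = (\<integral>\<^sup>+x. \<integral>\<^sup>+y. f (Complex (0 + (- b) * y) (0 + b * x)) \<partial>lborel \<partial>lborel)"
      by (rule lborel_pair.Fubini') simp
    finally show ?thesis
      by (simp add: mult True)
  next
    case False
    \<comment> \<open>The first substitution leaves \<open>b * u / a + y / a\<close> as second
      coordinate. Inserting \<open>u = a * x - b * y\<close> must give the second coordinate of the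
      rotated point, which is where \<open>a * a + b * b = 1\<close> enters.\<close>
    have shear: "b * (- b * y + a * x) / a + (1 / a) * y = b * x + a * y" for x y
    proof -
      have "b * (- b * y + a * x) / a + (1 / a) * y = (y * (1 - b * b) + a * b * x) / a"
        using False by (simp add: field_simps)
      also have "1 - b * b = a * a"
        using ab by simp
      finally show ?thesis
        using False by (simp add: field_simps)
    qed
    have cancel: "ennreal (1 / \<bar>a\<bar>) * ennreal \<bar>a\<bar> = 1"
      using False by (simp add: ennreal_mult'[symmetric])
    have "(\<integral>\<^sup>+x. \<integral>\<^sup>+y. f (Complex x y) \<partial>lborel \<partial>lborel) =
        (\<integral>\<^sup>+u. \<bar>1 / a\<bar> * (\<integral>\<^sup>+y. f (Complex u (b * u / a + (1 / a) * y)) \<partial>lborel) \<partial>lborel)"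
      using False
      by (intro nn_integral_cong) (rule nn_integral_real_affine; simp)
    also have "\<dots> = \<bar>1 / a\<bar> * (\<integral>\<^sup>+u. \<integral>\<^sup>+y. f (Complex u (b * u / a + (1 / a) * y)) \<partial>lborel \<partial>lborel)"
      by (rule nn_integral_cmult) simp
    also have "(\<integral>\<^sup>+u. \<integral>\<^sup>+y. f (Complex u (b * u / a + (1 / a) * y)) \<partial>lborel \<partial>lborel) =
        (\<integral>\<^sup>+y. \<integral>\<^sup>+u. f (Complex u (b * u / a + (1 / a) * y)) \<partial>lborel \<partial>lborel)"
      by (rule lborel_pair.Fubini') simp
    also have "\<dots> = (\<integral>\<^sup>+y. \<bar>a\<bar> * (\<integral>\<^sup>+x. f (Complex (- b * y + a * x)
        (b * (- b * y + a * x) / a + (1 / a) * y)) \<partial>lborel) \<partial>lborel)"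
      using False
      by (intro nn_integral_cong) (rule nn_integral_real_affine; simp)
    also have "\<dots> = (\<integral>\<^sup>+y. \<bar>a\<bar> * (\<integral>\<^sup>+x. f (c * Complex x y) \<partial>lborel) \<partial>lborel)"
      unfolding shear by (simp add: mult)
    also have "\<dots> = \<bar>a\<bar> * (\<integral>\<^sup>+y. \<integral>\<^sup>+x. f (c * Complex x y) \<partial>lborel \<partial>lborel)"
      by (rule nn_integral_cmult) simp
    also have "(\<integral>\<^sup>+y. \<integral>\<^sup>+x. f (c * Complex x y) \<partial>lborel \<partial>lborel) =
        (\<integral>\<^sup>+x. \<integral>\<^sup>+y. f (c * Complex x y) \<partial>lborel \<partial>lborel)"
      by (rule lborel_pair.Fubini') simp
    finally show ?thesis
      by (simp add: mult.assoc[symmetric] cancel)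
  qed
qed

text \<open>The density is radial, so it can be absorbed into the integrand of the rotation lemma
  for Lebesgue measure.\<close>

lemma nn_integral_complex_normal_rotation:
  fixes f :: "complex \<Rightarrow> ennreal"
  assumes "0 < v" "cmod c = 1" and [measurable]: "f \<in> borel_measurable borel"
  shows "(\<integral>\<^sup>+z. f (c * z) \<partial>complex_normal v) = (\<integral>\<^sup>+z. f z \<partial>complex_normal v)"
  using assms nn_integral_lborel_rotation[of c "\<lambda>z. ennreal (exp (- (cmod z)\<^sup>2 / v) / (pi * v)) * f z"]
  by (simp add: nn_integral_complex_normal_density norm_mult)

section \<open>Scaling and addition of independent Gaussians\<close>

lemma nn_integral_component_normal_scale:
  fixes f :: "real \<Rightarrow> ennreal"
  assumes "0 < v" "0 < r" and [measurable]: "f \<in> borel_measurable borel"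
  shows "(\<integral>\<^sup>+x. f (r * x) \<partial>component_normal v) = (\<integral>\<^sup>+x. f x \<partial>component_normal (r\<^sup>2 * v))"
proof -
  have "(\<integral>\<^sup>+x. f x \<partial>component_normal (r\<^sup>2 * v)) =
      \<bar>r\<bar> * (\<integral>\<^sup>+x. normal_density 0 (sqrt (r\<^sup>2 * v / 2)) (0 + r * x) * f (0 + r * x) \<partial>lborel)"
    using assms by (subst nn_integral_component_normal, simp, subst nn_integral_real_affine[where c = r and t = 0]) auto
  also have "\<dots> = (\<integral>\<^sup>+x. normal_density 0 (sqrt (v / 2)) x * f (r * x) \<partial>lborel)"
    using assms component_normal_density[of "r\<^sup>2 * v"]
    by (simp add: component_normal_density nn_integral_cmult[symmetric] mult.assoc[symmetric] ennreal_mult'[symmetric]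
        real_sqrt_mult power_mult_distrib)
  finally show ?thesis
    using assms by (simp add: nn_integral_component_normal)
qed

text \<open>The left-hand side integrates against a convolution, and centred normal densities
  convolve by adding their variances \<open>u / 2\<close> and \<open>v / 2\<close>.\<close>

lemma nn_integral_component_normal_add:
  fixes f :: "real \<Rightarrow> ennreal"
  assumes "0 < u" "0 < v" and [measurable]: "f \<in> borel_measurable borel"
  shows "(\<integral>\<^sup>+x. \<integral>\<^sup>+y. f (x + y) \<partial>component_normal v \<partial>component_normal u) = (\<integral>\<^sup>+x. f x \<partial>component_normal (u + v))"
proof -
  interpret U: prob_space "component_normal u"
    using assms(1) by (rule prob_space_component_normal)
  interpret V: prob_space "component_normal v"
    using assms(2) by (rule prob_space_component_normal)
  have fin: "finite_measure (component_normal u)" "finite_measure (component_normal v)"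
    by unfold_locales
  have "component_normal u \<star> component_normal v = component_normal (u + v)"
    using fin assms unfolding component_normal_def
    by (subst convolution_density)
       (simp_all add: ennreal_mult'[symmetric] conv_normal_density_zero_mean add_divide_distrib)
  with fin show ?thesis
    by (metis assms(3) nn_integral_convolution sets_component_normal)
qed

text \<open>Polar decomposition of \<open>c\<close>: the phase \<open>sgn c\<close> is absorbed by
  rotation invariance, and the modulus scales each real component separately.\<close>

lemma nn_integral_complex_normal_scale:
  fixes f :: "complex \<Rightarrow> ennreal"
  assumes "0 < v" "c \<noteq> 0" and [measurable]: "f \<in> borel_measurable borel"
  shows "(\<integral>\<^sup>+z. f (c * z) \<partial>complex_normal v) = (\<integral>\<^sup>+z. f z \<partial>complex_normal ((cmod c)\<^sup>2 * v))"
proof -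
  define r where "r = cmod c"
  have r: "0 < r" and c: "c = sgn c * complex_of_real r" "cmod (sgn c) = 1"
    using assms by (auto simp: r_def sgn_eq norm_divide)
  interpret N: prob_space "component_normal v"
    using assms(1) by (rule prob_space_component_normal)
  interpret R: prob_space "component_normal (r\<^sup>2 * v)"
    using assms(1) r by (intro prob_space_component_normal) simp
  have "(\<integral>\<^sup>+z. f (c * z) \<partial>complex_normal v) = (\<integral>\<^sup>+z. f (of_real r * (sgn c * z)) \<partial>complex_normal v)"
    by (subst c(1)) (simp add: mult_ac)
  also have "\<dots> = (\<integral>\<^sup>+z. f (of_real r * z) \<partial>complex_normal v)"
    using assms c by (intro nn_integral_complex_normal_rotation[where f = "\<lambda>z. f (of_real r * z)"]) auto
  also have "\<dots> = (\<integral>\<^sup>+x. \<integral>\<^sup>+y. f (Complex (r * x) (r * y)) \<partial>component_normal v \<partial>component_normal v)"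
    using assms by (simp add: nn_integral_complex_normal complex_of_real_mult_Complex)
  also have "\<dots> = (\<integral>\<^sup>+x. \<integral>\<^sup>+y. f (Complex (r * x) y) \<partial>component_normal (r\<^sup>2 * v) \<partial>component_normal v)"
    using assms r
    by (intro nn_integral_cong nn_integral_component_normal_scale[where f = "\<lambda>y. f (Complex _ y)"]) auto
  also have "\<dots> = (\<integral>\<^sup>+x. \<integral>\<^sup>+y. f (Complex x y) \<partial>component_normal (r\<^sup>2 * v) \<partial>component_normal (r\<^sup>2 * v))"
    using assms r
    by (intro nn_integral_component_normal_scale[where f = "\<lambda>x. \<integral>\<^sup>+y. f (Complex x y) \<partial>component_normal (r\<^sup>2 * v)"]) auto
  also have "\<dots> = (\<integral>\<^sup>+z. f z \<partial>complex_normal (r\<^sup>2 * v))"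
    using assms r by (simp add: nn_integral_complex_normal)
  finally show ?thesis
    by (simp add: r_def)
qed

text \<open>Complex addition is componentwise. Exchanging the two middle integrals brings the real
  parts together and the imaginary parts together, and each pair is a one-dimensional sum.\<close>

lemma nn_integral_complex_normal_add:
  fixes f :: "complex \<Rightarrow> ennreal"
  assumes "0 < u" "0 < v" and [measurable]: "f \<in> borel_measurable borel"
  shows "(\<integral>\<^sup>+z. \<integral>\<^sup>+w. f (z + w) \<partial>complex_normal v \<partial>complex_normal u) =
    (\<integral>\<^sup>+z. f z \<partial>complex_normal (u + v))"
proof -
  interpret U: prob_space "component_normal u"
    using assms(1) by (rule prob_space_component_normal)
  interpret V: prob_space "component_normal v"
    using assms(2) by (rule prob_space_component_normal)
  interpret UV: prob_space "component_normal (u + v)"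
    using assms by (intro prob_space_component_normal) simp
  interpret CV: prob_space "complex_normal v"
    using assms(2) by (rule prob_space_complex_normal)
  interpret pair_sigma_finite "component_normal u" "component_normal v" ..
  have "(\<integral>\<^sup>+z. \<integral>\<^sup>+w. f (z + w) \<partial>complex_normal v \<partial>complex_normal u) =
      (\<integral>\<^sup>+x. \<integral>\<^sup>+y. \<integral>\<^sup>+x'. \<integral>\<^sup>+y'. f (Complex (x + x') (y + y'))
        \<partial>component_normal v \<partial>component_normal v \<partial>component_normal u \<partial>component_normal u)"
    using assms by (simp add: nn_integral_complex_normal complex_add)
  also have "\<dots> = (\<integral>\<^sup>+x. \<integral>\<^sup>+x'. \<integral>\<^sup>+y. \<integral>\<^sup>+y'. f (Complex (x + x') (y + y'))
        \<partial>component_normal v \<partial>component_normal u \<partial>component_normal v \<partial>component_normal u)"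
    by (intro nn_integral_cong Fubini'[symmetric]) simp
  also have "\<dots> = (\<integral>\<^sup>+x. \<integral>\<^sup>+x'. \<integral>\<^sup>+y. f (Complex (x + x') y)
        \<partial>component_normal (u + v) \<partial>component_normal v \<partial>component_normal u)"
    using assms
    by (intro nn_integral_cong nn_integral_component_normal_add[where f = "\<lambda>y. f (Complex _ y)"]) auto
  also have "\<dots> = (\<integral>\<^sup>+x. \<integral>\<^sup>+y. f (Complex x y) \<partial>component_normal (u + v) \<partial>component_normal (u + v))"
    using assms
    by (intro nn_integral_component_normal_add[where f = "\<lambda>x. \<integral>\<^sup>+y. f (Complex x y) \<partial>component_normal (u + v)"]) auto
  also have "\<dots> = (\<integral>\<^sup>+z. f z \<partial>complex_normal (u + v))"
    using assms by (simp add: nn_integral_complex_normal)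
  finally show ?thesis .
qed

section \<open>The law of the squared modulus\<close>

lemma emeasure_complex_normal_tail:
  assumes "0 < v" "0 \<le> a"
  shows "emeasure (complex_normal v) {z. a < (cmod z)\<^sup>2} = exp (- a / v)"
proof -
  \<comment> \<open>The density is an integral of indicators of discs, whose areas are known; this avoids polar
    coordinates.\<close>
  have layer: "ennreal (exp (- q / v) / (pi * v)) =
      (\<integral>\<^sup>+w. ennreal (exp (- w / v) / (pi * v\<^sup>2)) * indicator {q..} w \<partial>lborel)" if "0 \<le> q" for q
  proof -
    have "((\<lambda>w. - (exp (- w / v) / (pi * v))) \<longlongrightarrow> 0) at_top"
      using assms(1) by real_asymp
    then show ?thesis
      using assms(1)
      by (subst nn_integral_FTC_atLeast[where F = "\<lambda>w. - (exp (- w / v) / (pi * v))" and T = 0])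
         (auto intro!: derivative_eq_intros simp: power2_eq_square)
  qed
  have sqrt_less: "sqrt q < norm p \<longleftrightarrow> q < (norm p)\<^sup>2" for q and p :: "real \<times> real"
    by (metis abs_norm_cancel real_sqrt_abs real_sqrt_less_iff)
  then have sqrt_ge: "norm p \<le> sqrt q \<longleftrightarrow> (norm p)\<^sup>2 \<le> q" for q and p :: "real \<times> real"
    by (metis not_le)
  \<comment> \<open>The set is an annulus, a difference of two discs. For \<open>w < a\<close> it is
    empty, and \<open>ennreal\<close> truncates the negative right-hand side to 0, so one formula
    serves for all \<open>w\<close>.\<close>
  have area: "emeasure lborel {p :: real \<times> real. a < (norm p)\<^sup>2 \<and> (norm p)\<^sup>2 \<le> w} = ennreal (pi * (w - a))" for w
  proof (cases "a \<le> w")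
    case True
    have "{p :: real \<times> real. a < (norm p)\<^sup>2 \<and> (norm p)\<^sup>2 \<le> w} = cball 0 (sqrt w) - cball 0 (sqrt a)"
      by (auto simp: sqrt_ge)
    also have "emeasure lborel \<dots> = ennreal (pi * (w - a))"
      using assms(2) True
      by (subst emeasure_Diff) (simp_all add: emeasure_cball unit_ball_vol_2 ennreal_minus right_diff_distrib subset_cball)
    finally show ?thesis .
  next
    case False
    then have "{p :: real \<times> real. a < (norm p)\<^sup>2 \<and> (norm p)\<^sup>2 \<le> w} = {}"
      by auto
    then show ?thesis
      using False by (simp only: emeasure_empty) (simp add: ennreal_neg mult_nonneg_nonpos)
  qed
  \<comment> \<open>Passing to \<open>real \<times> real\<close>, whose Lebesgue measure is the
    product measure, turns the iterated integral into a single integral over the plane.\<close>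
  have norm_eq: "cmod (Complex x y) = norm (x, y)" for x y
    by (simp add: cmod_def norm_Pair)
  have "emeasure (complex_normal v) {z. a < (cmod z)\<^sup>2} =
      (\<integral>\<^sup>+z. indicator {z. a < (cmod z)\<^sup>2} z \<partial>complex_normal v)"
    by (rule nn_integral_indicator[symmetric]) simp
  also have "\<dots> = (\<integral>\<^sup>+p. ennreal (exp (- (norm p)\<^sup>2 / v) / (pi * v)) * indicator {p. a < (norm p)\<^sup>2} p
      \<partial>(lborel :: (real \<times> real) measure))"
    using assms(1)
    by (subst nn_integral_complex_normal_density)
       (simp_all add: lborel.nn_integral_fst[of _ lborel, unfolded lborel_prod, symmetric] norm_eq indicator_def)
  also have "\<dots> = (\<integral>\<^sup>+p. \<integral>\<^sup>+w. ennreal (exp (- w / v) / (pi * v\<^sup>2)) *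
      indicator {p. a < (norm p)\<^sup>2 \<and> (norm p)\<^sup>2 \<le> w} p \<partial>lborel \<partial>(lborel :: (real \<times> real) measure))"
    by (subst layer)
       (auto intro!: nn_integral_cong simp: nn_integral_multc[symmetric] split: split_indicator)
  also have "\<dots> = (\<integral>\<^sup>+w. \<integral>\<^sup>+p. ennreal (exp (- w / v) / (pi * v\<^sup>2)) *
      indicator {p. a < (norm p)\<^sup>2 \<and> (norm p)\<^sup>2 \<le> w} p \<partial>(lborel :: (real \<times> real) measure) \<partial>lborel)"
    by (rule lborel_pair.Fubini') (simp add: indicator_def)
  also have "\<dots> = (\<integral>\<^sup>+w. ennreal (exp (- w / v) / (pi * v\<^sup>2)) * ennreal (pi * (w - a)) \<partial>lborel)"
    by (simp add: nn_integral_cmult area)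
  \<comment> \<open>The shift \<open>w = a + t\<close> splits off the factor
    \<open>exp (- a / v)\<close>. What remains is \<open>t * exp (- t / v) / v\<^sup>2\<close>, the
    Erlang density of shape 2 (index 1 in \<open>erlang_density\<close>), whose total mass, the
    moment of order 0, is 1.\<close>
  also have "\<dots> = (\<integral>\<^sup>+t. ennreal (exp (- (a + 1 * t) / v) / (pi * v\<^sup>2)) * ennreal (pi * (a + 1 * t - a)) \<partial>lborel)"
    by (subst nn_integral_real_affine[where c = 1 and t = a]) auto
  also have "\<dots> = (\<integral>\<^sup>+t. ennreal (exp (- a / v)) * ennreal (erlang_density 1 (1 / v) t) \<partial>lborel)"
    using assms(1)
    by (intro nn_integral_cong)
       (auto simp: erlang_density_def ennreal_mult'[symmetric] ennreal_neg mult_nonpos_nonneg exp_add[symmetric]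
         power2_eq_square field_simps)
  also have "\<dots> = exp (- a / v)"
    using assms(1) nn_integral_erlang_ith_moment[of "1 / v" 1 0] by (simp add: nn_integral_cmult)
  finally show ?thesis .
qed

text \<open>The tail formula determines the distribution function. With \<open>v = 1\<close> this
  replaces the integral over \<open>G\<^sub>3\<close> by one over its squared modulus.\<close>

lemma distributed_complex_normal_cmod_squared:
  assumes "0 < v"
  shows "distributed (complex_normal v) lborel (\<lambda>z. (cmod z)\<^sup>2) (exponential_density (1 / v))"
proof -
  interpret prob_space "complex_normal v"
    using assms by (rule prob_space_complex_normal)
  show ?thesis
  proof (rule exponential_distributedI)
    fix a :: real
    assume a: "0 \<le> a"
    have "{z. (cmod z)\<^sup>2 \<le> a} = space (complex_normal v) - {z. a < (cmod z)\<^sup>2}"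
      by auto
    also have "emeasure (complex_normal v) \<dots> = 1 - ennreal (exp (- a / v))"
      using a assms by (subst emeasure_compl) (auto simp: emeasure_complex_normal_tail emeasure_space_1[simplified])
    also have "\<dots> = 1 - ennreal (exp (- a * (1 / v)))"
      by simp
    finally show "emeasure (complex_normal v) {z \<in> space (complex_normal v). (cmod z)\<^sup>2 \<le> a} =
        1 - ennreal (exp (- a * (1 / v)))"
      by simp
  qed (use assms in auto)
qed

section \<open>From the random variables of the channel to iterated integrals\<close>

text \<open>Independence makes the joint law of real and imaginary part a product, which
  \<open>Complex\<close> pushes forward to \<open>complex_normal\<close>.\<close>

lemma (in prob_space) circular_complex_gaussian_distr:
  assumes "circular_complex_gaussian M v Z"
  shows "Z \<in> borel_measurable M" and "distr M borel Z = complex_normal v"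
proof -
  have ind: "indep_var borel (\<lambda>x. Re (Z x)) borel (\<lambda>x. Im (Z x))"
    and Re: "distributed M lborel (\<lambda>x. Re (Z x)) (normal_density 0 (sqrt (v / 2)))"
    and Im: "distributed M lborel (\<lambda>x. Im (Z x)) (normal_density 0 (sqrt (v / 2)))"
    using assms by (auto simp: circular_complex_gaussian_def)
  have [measurable]: "(\<lambda>x. Re (Z x)) \<in> borel_measurable M" "(\<lambda>x. Im (Z x)) \<in> borel_measurable M"
    using distributed_measurable[OF Re] distributed_measurable[OF Im] by auto
  then show "Z \<in> borel_measurable M"
    by (simp add: borel_measurable_complex_iff)
  have "distr M borel (\<lambda>x. Re (Z x)) = component_normal v" "distr M borel (\<lambda>x. Im (Z x)) = component_normal v"
    using distributed_distr_eq_density[OF Re] distributed_distr_eq_density[OF Im]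
    by (simp_all add: component_normal_def cong: distr_cong)
  then have "component_normal v \<Otimes>\<^sub>M component_normal v = distr M (borel \<Otimes>\<^sub>M borel) (\<lambda>x. (Re (Z x), Im (Z x)))"
    using ind by (simp add: indep_var_distribution_eq)
  then show "distr M borel Z = complex_normal v"
    by (simp add: complex_normal_def distr_distr comp_def case_prod_beta)
qed

text \<open>The conditional tail probability given \<open>G\<^sub>3 = z\<close>. For
  \<open>z \<noteq> 0\<close> the term \<open>of_real s * y * z\<close> is again Gaussian by
  scaling, and adding the scaled \<open>x\<close> adds the variances.\<close>

lemma complex_normal_combination_tail:
  fixes z :: complex
  assumes "0 \<le> r" "0 < s" "z \<noteq> 0" "0 \<le> c"
  shows "(\<integral>\<^sup>+x. \<integral>\<^sup>+y. indicator {u. c < (cmod u)\<^sup>2} (of_real r * x + of_real s * y * z)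
      \<partial>complex_normal 1 \<partial>complex_normal 1) = exp (- c / (r\<^sup>2 + s\<^sup>2 * (cmod z)\<^sup>2))" (is "?I = _")
proof -
  interpret N: prob_space "complex_normal 1"
    by (rule prob_space_complex_normal) simp
  define v where "v = s\<^sup>2 * (cmod z)\<^sup>2"
  have v: "0 < v" "(cmod (z * of_real s))\<^sup>2 = v" and sz: "of_real s * z \<noteq> 0"
    using assms by (simp_all add: v_def norm_mult power_mult_distrib)
  interpret V: prob_space "complex_normal v"
    using v by (intro prob_space_complex_normal)
  have "?I = (\<integral>\<^sup>+x. \<integral>\<^sup>+y. indicator {u. c < (cmod u)\<^sup>2} (of_real r * x + y)
      \<partial>complex_normal v \<partial>complex_normal 1)"
    using nn_integral_complex_normal_scale[OF zero_less_one sz, of "\<lambda>y. indicator {u. c < (cmod u)\<^sup>2} (of_real r * _ + y)"]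
    by (simp add: v mult_ac)
  also have "\<dots> = (\<integral>\<^sup>+u. indicator {u. c < (cmod u)\<^sup>2} u \<partial>complex_normal (r\<^sup>2 + v))"
  \<comment> \<open>For \<open>r = 0\<close>, the pure double-Rayleigh case, scaling
    \<open>x\<close> would give the degenerate variance 0. There the inner integral does not depend
    on \<open>x\<close>, and the outer measure has mass 1.\<close>
  proof (cases "r = 0")
    case True
    then show ?thesis
      by (simp add: N.emeasure_space_1[simplified])
  next
    case False
    then have r: "0 < r\<^sup>2" "of_real r \<noteq> (0::complex)"
      by auto
    have "(\<integral>\<^sup>+x. \<integral>\<^sup>+y. indicator {u. c < (cmod u)\<^sup>2} (of_real r * x + y) \<partial>complex_normal v \<partial>complex_normal 1) =
      (\<integral>\<^sup>+x. \<integral>\<^sup>+y. indicator {u. c < (cmod u)\<^sup>2} (x + y) \<partial>complex_normal v \<partial>complex_normal (r\<^sup>2))"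
      using nn_integral_complex_normal_scale[OF zero_less_one r(2),
          of "\<lambda>x. \<integral>\<^sup>+y. indicator {u. c < (cmod u)\<^sup>2} (x + y) \<partial>complex_normal v"]
      by simp
    also have "\<dots> = (\<integral>\<^sup>+u. indicator {u. c < (cmod u)\<^sup>2} u \<partial>complex_normal (r\<^sup>2 + v))"
      using r(1) v(1) by (rule nn_integral_complex_normal_add) simp
    finally show ?thesis .
  qed
  also have "\<dots> = exp (- c / (r\<^sup>2 + v))"
    using v assms by (simp add: emeasure_complex_normal_tail add_nonneg_pos)
  finally show ?thesis
    by (simp add: v_def)
qed

text \<open>\<open>indep_var_restrict\<close> yields independence of tuples in product spaces;
  \<open>f\<close> and \<open>g\<close> serve to read off the wanted coordinates.\<close>

lemma (in prob_space) indep_var_distr_pair: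
  assumes ind: "indep_var S X T Y" and [measurable]: "f \<in> measurable S S'" "g \<in> measurable T T'"
  shows "distr M (S' \<Otimes>\<^sub>M T') (\<lambda>x. (f (X x), g (Y x))) =
    distr M S' (\<lambda>x. f (X x)) \<Otimes>\<^sub>M distr M T' (\<lambda>x. g (Y x))"
proof -
  have [measurable]: "X \<in> measurable M S" "Y \<in> measurable M T"
    using ind by (auto simp: indep_var_distribution_eq)
  interpret D: prob_space "distr M T' (\<lambda>x. g (Y x))"
    by (rule prob_space_distr) measurable
  have "distr M S' (\<lambda>x. f (X x)) \<Otimes>\<^sub>M distr M T' (\<lambda>x. g (Y x)) =
      distr (distr M S X) S' f \<Otimes>\<^sub>M distr (distr M T Y) T' g"
    by (simp add: distr_distr comp_def)
  also have "\<dots> = distr (distr M S X \<Otimes>\<^sub>M distr M T Y) (S' \<Otimes>\<^sub>M T') (\<lambda>(x, y). (f x, g y))"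
    using D.sigma_finite_measure_axioms by (intro pair_measure_distr) (simp_all add: distr_distr comp_def)
  also have "distr M S X \<Otimes>\<^sub>M distr M T Y = distr M (S \<Otimes>\<^sub>M T) (\<lambda>x. (X x, Y x))"
    using ind by (simp add: indep_var_distribution_eq)
  finally show ?thesis
    by (simp add: distr_distr comp_def)
qed

text \<open>Index 3 is first separated from indices 1 and 2, and then 1 from 2.
  \<open>G\<^sub>3\<close> comes first so that its integral is outermost, ready for
  conditioning.\<close>

lemma (in sosf_channel) distr_gaussians:
  "distr M (borel \<Otimes>\<^sub>M (borel \<Otimes>\<^sub>M borel)) (\<lambda>x. (G\<^sub>3 x, G\<^sub>1 x, G\<^sub>2 x)) =
    complex_normal 1 \<Otimes>\<^sub>M (complex_normal 1 \<Otimes>\<^sub>M complex_normal 1)"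
proof -
  let ?X = "\<lambda>i. [\<lambda>x. complex_of_real (\<phi> x), G\<^sub>1, G\<^sub>2, G\<^sub>3] ! i"
  have "indep_var (PiM {3} (\<lambda>_. borel)) (\<lambda>x. restrict (\<lambda>i. ?X i x) {3})
      (PiM {1, 2} (\<lambda>_. borel)) (\<lambda>x. restrict (\<lambda>i. ?X i x) {1, 2})"
    by (rule indep_var_restrict[OF independent]) auto
  from indep_var_distr_pair[OF this, of "\<lambda>h. h 3" borel "\<lambda>h. (h 1, h 2)" "borel \<Otimes>\<^sub>M borel"]
  have 312: "distr M (borel \<Otimes>\<^sub>M (borel \<Otimes>\<^sub>M borel)) (\<lambda>x. (G\<^sub>3 x, G\<^sub>1 x, G\<^sub>2 x)) =
      distr M borel G\<^sub>3 \<Otimes>\<^sub>M distr M (borel \<Otimes>\<^sub>M borel) (\<lambda>x. (G\<^sub>1 x, G\<^sub>2 x))"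
    by simp
  have "indep_var (PiM {1} (\<lambda>_. borel)) (\<lambda>x. restrict (\<lambda>i. ?X i x) {1})
      (PiM {2} (\<lambda>_. borel)) (\<lambda>x. restrict (\<lambda>i. ?X i x) {2})"
    by (rule indep_var_restrict[OF independent]) auto
  from indep_var_distr_pair[OF this, of "\<lambda>h. h 1" borel "\<lambda>h. h 2" borel]
  have "distr M (borel \<Otimes>\<^sub>M borel) (\<lambda>x. (G\<^sub>1 x, G\<^sub>2 x)) = distr M borel G\<^sub>1 \<Otimes>\<^sub>M distr M borel G\<^sub>2"
    by simp
  with 312 show ?thesis
    by (simp add: gaussian[THEN circular_complex_gaussian_distr(2)])
qed

lemma (in sosf_channel) emeasure_rdr_tail:
  assumes "\<omega>\<^sub>0 = 0" "0 < \<omega>\<^sub>2" "0 \<le> c"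
  shows "emeasure M {x \<in> space M. c < (cmod (sosf \<omega>\<^sub>0 \<omega>\<^sub>1 \<omega>\<^sub>2 \<phi> G\<^sub>1 G\<^sub>2 G\<^sub>3 x))\<^sup>2} =
    (\<integral>\<^sup>+u. exponential_density 1 u * exp (- c / (\<omega>\<^sub>1\<^sup>2 + \<omega>\<^sub>2\<^sup>2 * u)) \<partial>lborel)"
proof -
  note [measurable] = gaussian[THEN circular_complex_gaussian_distr(1)]
  interpret N: prob_space "complex_normal 1"
    by (rule prob_space_complex_normal) simp
  interpret NN: pair_prob_space "complex_normal 1" "complex_normal 1" ..
  let ?f = "\<lambda>(z, x, y). indicator {u. c < (cmod u)\<^sup>2} (of_real \<omega>\<^sub>1 * x + of_real \<omega>\<^sub>2 * y * z) :: ennreal"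
  \<comment> \<open>The conditional tail formula excludes \<open>z = 0\<close>. This point is null
    because the tail at level 0 already has mass 1.\<close>
  have "emeasure (complex_normal 1) {0} = 0"
  proof -
    have "{0} = space (complex_normal 1) - {z. 0 < (cmod z)\<^sup>2}"
      by auto
    also have "emeasure (complex_normal 1) \<dots> = 0"
      using emeasure_complex_normal_tail[of 1 0]
      by (subst emeasure_compl) (simp_all add: N.emeasure_space_1[simplified] del: zero_less_power2 zero_less_norm_iff)
    finally show ?thesis .
  qed
  then have ae: "AE z in complex_normal 1. z \<noteq> 0"
    by (intro AE_I[where N = "{0}"]) auto
  have "emeasure M {x \<in> space M. c < (cmod (sosf \<omega>\<^sub>0 \<omega>\<^sub>1 \<omega>\<^sub>2 \<phi> G\<^sub>1 G\<^sub>2 G\<^sub>3 x))\<^sup>2} =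
      (\<integral>\<^sup>+x. indicator {x \<in> space M. c < (cmod (sosf \<omega>\<^sub>0 \<omega>\<^sub>1 \<omega>\<^sub>2 \<phi> G\<^sub>1 G\<^sub>2 G\<^sub>3 x))\<^sup>2} x \<partial>M)"
    using assms by (intro nn_integral_indicator[symmetric]) (simp add: sosf_def)
  also have "\<dots> = (\<integral>\<^sup>+x. ?f (G\<^sub>3 x, G\<^sub>1 x, G\<^sub>2 x) \<partial>M)"
    using assms by (intro nn_integral_cong) (simp add: sosf_def indicator_def)
  also have "\<dots> = (\<integral>\<^sup>+p. ?f p \<partial>distr M (borel \<Otimes>\<^sub>M (borel \<Otimes>\<^sub>M borel)) (\<lambda>x. (G\<^sub>3 x, G\<^sub>1 x, G\<^sub>2 x)))"
    by (rule nn_integral_distr[symmetric]) measurable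
  also have "\<dots> = (\<integral>\<^sup>+z. \<integral>\<^sup>+x. \<integral>\<^sup>+y. ?f (z, x, y) \<partial>complex_normal 1 \<partial>complex_normal 1 \<partial>complex_normal 1)"
    unfolding distr_gaussians
    by (simp add: NN.P.nn_integral_fst[symmetric] N.nn_integral_fst[symmetric] case_prod_beta)
  also have "\<dots> = (\<integral>\<^sup>+z. ennreal (exp (- c / (\<omega>\<^sub>1\<^sup>2 + \<omega>\<^sub>2\<^sup>2 * (cmod z)\<^sup>2))) \<partial>complex_normal 1)"
    using ae assms weights_nonneg
    by (intro nn_integral_cong_AE) (auto simp: complex_normal_combination_tail)
  also have "\<dots> = (\<integral>\<^sup>+u. exponential_density 1 u * exp (- c / (\<omega>\<^sub>1\<^sup>2 + \<omega>\<^sub>2\<^sup>2 * u)) \<partial>lborel)"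
    using distributed_nn_integral[OF distributed_complex_normal_cmod_squared[OF zero_less_one],
        of "\<lambda>u. ennreal (exp (- c / (\<omega>\<^sub>1\<^sup>2 + \<omega>\<^sub>2\<^sup>2 * u)))"]
    by (simp add: ennreal_mult')
  finally show ?thesis .
qed

theorem mainTheorem8:
  fixes M :: "'a measure"
    and \<omega>\<^sub>0 \<omega>\<^sub>1 \<omega>\<^sub>2 \<alpha> \<beta> \<gamma>bar g :: real
    and \<phi> :: "'a \<Rightarrow> real"
    and G\<^sub>1 G\<^sub>2 G\<^sub>3 :: "'a \<Rightarrow> complex"
  assumes "sosf_channel M \<omega>\<^sub>0 \<omega>\<^sub>1 \<omega>\<^sub>2 \<phi> G\<^sub>1 G\<^sub>2 G\<^sub>3"
    and "\<alpha> = \<omega>\<^sub>2\<^sup>2" and "\<beta> = \<omega>\<^sub>0\<^sup>2" and "\<beta> = 0"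
    and "0 < \<gamma>bar" and "0 < \<alpha>" and "\<alpha> \<le> 1" and "0 < g"
  shows "cdf (distr M borel (snr \<gamma>bar (sosf \<omega>\<^sub>0 \<omega>\<^sub>1 \<omega>\<^sub>2 \<phi> G\<^sub>1 G\<^sub>2 G\<^sub>3))) g =
    1 - exp ((1 - \<alpha>) / \<alpha>) * gen_incomplete_Gamma 1 ((1 - \<alpha>) / \<alpha>) (g / (\<alpha> * \<gamma>bar))"
proof -
  interpret sosf_channel M \<omega>\<^sub>0 \<omega>\<^sub>1 \<omega>\<^sub>2 \<phi> G\<^sub>1 G\<^sub>2 G\<^sub>3
    by fact
  note [measurable] = gaussian[THEN circular_complex_gaussian_distr(1)]
  define S where "S = sosf \<omega>\<^sub>0 \<omega>\<^sub>1 \<omega>\<^sub>2 \<phi> G\<^sub>1 G\<^sub>2 G\<^sub>3"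
  \<comment> \<open>The event that the SNR exceeds \<open>g\<close>; strictness makes its complement
    exactly the event measured by \<open>cdf\<close>.\<close>
  define T where "T = {x \<in> space M. g / \<gamma>bar < (cmod (S x))\<^sup>2}"
  define x0 where "x0 = (1 - \<alpha>) / \<alpha>"
  define b where "b = g / (\<alpha> * \<gamma>bar)"
  have \<omega>: "\<omega>\<^sub>0 = 0" "0 < \<omega>\<^sub>2" "\<omega>\<^sub>1\<^sup>2 = 1 - \<alpha>"
    using assms weights_nonneg normalized by (auto simp: zero_less_power2 order.strict_iff_order)
  have x0: "0 \<le> x0"
    using assms by (simp add: x0_def)
  have [measurable]: "S \<in> borel_measurable M"
    using \<omega> by (simp add: S_def sosf_def[abs_def])
  have [measurable]: "T \<in> sets M"
    by (simp add: T_def)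
  \<comment> \<open>Dividing numerator and denominator by \<alpha> matches the exponent
    \<open>b / t\<close> at \<open>t = x0 + u\<close> with the exponent of the tail formula.\<close>
  have arg: "b / (x0 + u) = (g / \<gamma>bar) / (\<omega>\<^sub>1\<^sup>2 + \<omega>\<^sub>2\<^sup>2 * u)" for u
  proof -
    have "x0 + u = (\<omega>\<^sub>1\<^sup>2 + \<omega>\<^sub>2\<^sup>2 * u) / \<alpha>"
      using assms(6) by (simp add: x0_def \<omega>(3) assms(2)[symmetric] field_simps)
    then show ?thesis
      using assms(6) by (simp add: b_def)
  qed
  \<comment> \<open>For a nonnegative measurable integrand this needs no integrability proof; the
    value later turns out to be \<open>exp (- x0)\<close> times a probability.\<close>
  have "gen_incomplete_Gamma 1 x0 b =
      enn2real (\<integral>\<^sup>+t. indicator {x0<..} t *\<^sub>R (t powr (1 - 1) * exp (- t) * exp (- b / t)) \<partial>lborel)"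
    unfolding gen_incomplete_Gamma_def set_lebesgue_integral_def
    by (rule integral_eq_nn_integral) auto
  also have "(\<integral>\<^sup>+t. indicator {x0<..} t *\<^sub>R (t powr (1 - 1) * exp (- t) * exp (- b / t)) \<partial>lborel) =
      (\<integral>\<^sup>+u. indicator {x0<..} (x0 + 1 * u) *\<^sub>R ((x0 + 1 * u) powr (1 - 1) *
        exp (- (x0 + 1 * u)) * exp (- b / (x0 + 1 * u))) \<partial>lborel)"
    by (subst nn_integral_real_affine[where c = 1 and t = x0]) auto
  \<comment> \<open>The sides differ at \<open>u = 0\<close>, which the open range
    \<open>{x0<..}\<close> omits but \<open>exponential_density\<close> includes, so equality holds
    only almost everywhere. For \<open>u > 0\<close> the base \<open>x0 + u\<close> is positive,
    hence its power with exponent 0 is 1.\<close>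
  also have "\<dots> = (\<integral>\<^sup>+u. exp (- x0) * ennreal (exponential_density 1 u *
        exp (- (g / \<gamma>bar) / (\<omega>\<^sub>1\<^sup>2 + \<omega>\<^sub>2\<^sup>2 * u))) \<partial>lborel)"
    using x0 AE_lborel_singleton[of 0]
    by (intro nn_integral_cong_AE)
       (auto simp: arg exponential_density_def exp_add[symmetric] exp_diff[symmetric]
         ennreal_mult'[symmetric] indicator_def)
  also have "\<dots> = exp (- x0) * emeasure M T"
    using emeasure_rdr_tail[OF \<omega>(1,2), of "g / \<gamma>bar"] assms(5,8)
    by (simp add: nn_integral_cmult T_def S_def)
  finally have Gamma: "gen_incomplete_Gamma 1 x0 b = exp (- x0) * prob T"
    by (simp add: enn2real_mult measure_def)
  have "cdf (distr M borel (snr \<gamma>bar S)) g = prob (snr \<gamma>bar S -` {..g} \<inter> space M)"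
    by (simp add: cdf_def measure_distr snr_def[abs_def])
  also have "snr \<gamma>bar S -` {..g} \<inter> space M = space M - T"
    using assms(5) by (auto simp: T_def snr_def field_simps not_less)
  also have "prob \<dots> = 1 - prob T"
    by (rule prob_compl) simp
  also have "\<dots> = 1 - exp x0 * gen_incomplete_Gamma 1 x0 b"
    by (simp add: Gamma mult.assoc[symmetric] exp_add[symmetric])
  finally show ?thesis
    by (simp add: S_def x0_def b_def)
qed

end
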